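(* Let $\Sigma=\{A_1,\dots,A_m\}\subset\mathbb{R}^{n\times n}$ be a set of matrices sharing an invariant proper cone $K\subset\mathbb{R}^n$, i.e. $A_jK\subset K$ for all $j=1,\dots,m$. If there is a matrix $A_i\in\Sigma$ which is $K$-primitive, then both quantities $$\max_{A\in\Sigma^t}\{\operatorname{trace}^{1/t}(A)\}\qquad\text{and}\qquad \max_{A\in\Sigma^t}\{\rho^{1/t}(A)\}$$ converge towards the joint spectral radius $\rho(\Sigma)$ when $t$ tends to $\infty$.
   Context: A cone $K\subset\mathbb{R}^n$ is proper if it is closed, convex, has nonempty interior, and contains no straight line. A matrix $A$ is $K$-positive if $A(K\setminus\{0\})\subset\operatorname{int}K$, and $K$-primitive if there exists a natural number $t$ such that $A^t$ is $K$-positive. $\Sigma^t$ denotes the set of all products of length $t$ of matrices in $\Sigma$ (repetitions allowed). For a single matrix $A$, $\rho(A)$ is its spectral radius, i.e. the maximal modulus of its eigenvalues; $\operatorname{trace}^{1/t}(A)$ and $\rho^{1/t}(A)$ denote $(\operatorname{trace}(A))^{1/t}$ and $(\rho(A))^{1/t}$. For the set $\Sigma$, the joint spectral radius is $$\rho(\Sigma)=\lim_{t\to\infty}\max\{\|A\|^{1/t}:A\in\Sigma^t\}.$$ The limit exists and does not depend on the matrix norm chosen. *)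

theory Defs
  imports "HOL-Analysis.Analysis"
begin

definition proper_cone :: "(real ^ 'n) set \<Rightarrow> bool" where
  "proper_cone K \<longleftrightarrow> cone K \<and> closed K \<and> convex K \<and> interior K \<noteq> {} \<and>
     \<not> (\<exists>x v. v \<noteq> 0 \<and> (\<forall>s::real. x + s *\<^sub>R v \<in> K))"

(* The operation x ^ t on type vec is componentwise, hence a separate matrix power. *)
primrec matrix_power :: "real ^ 'n ^ 'n \<Rightarrow> nat \<Rightarrow> real ^ 'n ^ 'n" where
  "matrix_power A 0 = mat 1"
| "matrix_power A (Suc t) = A ** matrix_power A t"

definition cone_positive :: "(real ^ 'n) set \<Rightarrow> real ^ 'n ^ 'n \<Rightarrow> bool" where
  "cone_positive K A \<longleftrightarrow> (\<lambda>x. A *v x) ` (K - {0}) \<subseteq> interior K"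

(* The exponent is required to be positive: in dimension one the identity matrix is
   K-positive, so that exponent 0 would make every 1 x 1 matrix, even 0, K-primitive. *)
definition cone_primitive :: "(real ^ 'n) set \<Rightarrow> real ^ 'n ^ 'n \<Rightarrow> bool" where
  "cone_primitive K A \<longleftrightarrow> (\<exists>t::nat. t \<ge> 1 \<and> cone_positive K (matrix_power A t))"

definition matrix_products :: "(real ^ 'n ^ 'n) set \<Rightarrow> nat \<Rightarrow> (real ^ 'n ^ 'n) set" where
  "matrix_products \<Sigma> t = {foldr (**) As (mat 1) | As. length As = t \<and> set As \<subseteq> \<Sigma>}"

(* Real matrices are complexified, so that non-real eigenvalues are included. *)
definition eigenvalues :: "real ^ 'n ^ 'n \<Rightarrow> complex set" where
  "eigenvalues A = {c. \<exists>v. v \<noteq> 0 \<and> map_matrix complex_of_real A *v v = c *s v}"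

definition spectral_radius :: "real ^ 'n ^ 'n \<Rightarrow> real" where
  "spectral_radius A = Max (cmod ` eigenvalues A)"

(* The matrix norm is the operator norm induced by the Euclidean norm;
   the value of the limit does not depend on this choice. *)
definition joint_spectral_radius :: "(real ^ 'n ^ 'n) set \<Rightarrow> real" where
  "joint_spectral_radius \<Sigma> =
     lim (\<lambda>t. Max ((\<lambda>A. root t (onorm (\<lambda>x. A *v x))) ` matrix_products \<Sigma> t))"

end

theory Submission
  imports Defs
begin

text \<open>
  Write \<open>M t\<close> for the largest operator norm of a product of length \<open>t\<close>. It is submultiplicative, so
  \<open>root t (M t)\<close> converges, and its limit is the joint spectral radius. Traces and spectral radii
  are at most a constant times the norm, so both statements follow from a lower bound of the same
  shape: there are \<open>N\<close> and \<open>c > 0\<close> such that every product \<open>A\<close> of length \<open>t\<close> can be extended to a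
  product \<open>B\<close> of length \<open>t + N\<close> whose trace, respectively spectral radius, is at least \<open>c\<close> times the
  norm of \<open>A\<close>. The factors \<open>c\<close> and \<open>M N\<close> disappear under the \<open>t\<close>-th root
  (\<open>root_max_tendsto_joint_spectral_radius\<close>).

  The extension is made with a \<open>K\<close>-positive power \<open>P\<close> of the primitive matrix. By Brouwer's theorem
  \<open>P\<close> has an eigenvector \<open>u\<close> in the interior of \<open>K\<close>, with an eigenvalue \<open>l > 0\<close>. The
  order of \<open>K\<close> controls norms: as \<open>u\<close> is an order unit and the cone is normal, the norm of a
  cone-preserving \<open>A\<close> is comparable with that of the single vector \<open>A u\<close>
  (\<open>proper_cone_onorm_le\<close>), and \<open>P y\<close> dominates a multiple of \<open>\<parallel>y\<parallel> u\<close> for \<open>y\<close> in \<open>K\<close>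
  (\<open>cone_positive_lower_bound\<close>).

  For the spectral radius take \<open>B = P A P\<close>. Then \<open>B u = l P A u\<close> dominates a multiple of
  \<open>\<parallel>A\<parallel> u\<close>, and this forces the Perron eigenvalue of \<open>B\<close> to be at least that multiple of
  \<open>\<parallel>A\<parallel>\<close> (\<open>cone_positive_sandwich_eigenvalue\<close>).

  For the trace take \<open>B = A P^k\<close> with a fixed large \<open>k\<close>. The trace of a cone-preserving matrix may be
  negative (a half turn of three-space about the axis of a circular cone has trace \<open>-1\<close>), so positivity alone
  does not suffice. However, \<open>P / l\<close> contracts the oscillation relative to \<open>u\<close>, so that \<open>(P / l)^k\<close> is
  close to a rank one matrix \<open>x \<mapsto> (m \<bullet> x) u\<close>. The trace of \<open>A (P / l)^k\<close> is then
  close to \<open>m \<bullet> A u\<close>, which is bounded below by a multiple of \<open>\<parallel>A u\<parallel>\<close>, whereas the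
  error is a small multiple of \<open>\<parallel>A\<parallel>\<close> (\<open>cone_positive_power_trace_ge\<close>).
\<close>

section \<open>Proper cones and their order\<close>

text \<open>
  The order of the cone, in which \<open>x\<close> is below \<open>y\<close> when \<open>y - x \<in> K\<close>, is written out in all
  statements.
\<close>

lemma proper_cone_add:
  assumes "proper_cone K" "x \<in> K" "y \<in> K"
  shows "x + y \<in> K"
  using assms convex_cone[of K] unfolding proper_cone_def by blast

lemma proper_cone_scale:
  assumes "proper_cone K" "x \<in> K" "0 \<le> c"
  shows "c *\<^sub>R x \<in> K"
  using assms unfolding proper_cone_def cone_def by blast

lemma proper_cone_pointed:
  assumes K: "proper_cone K" and x: "x \<in> K" "- x \<in> K"
  shows "x = 0"
proof (rule ccontr)
  assume "x \<noteq> 0"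
  moreover have "0 + s *\<^sub>R x \<in> K" for s
    using proper_cone_scale[OF K x(1), of s] proper_cone_scale[OF K x(2), of "- s"]
    by (cases "0 \<le> s") auto
  ultimately show False
    using K unfolding proper_cone_def by blast
qed

text \<open>Because the cone is pointed, no convex combination of its unit vectors vanishes; their convex hull
  is compact and can thus be separated strictly from the origin.\<close>

lemma proper_cone_functional:
  assumes K: "proper_cone K"
  obtains a b where "0 < b" "\<And>x. x \<in> K \<Longrightarrow> b * norm x \<le> a \<bullet> x"
proof -
  let ?S = "convex hull (K \<inter> sphere 0 1)"
  have "convex (K - {0})"
    unfolding convex_def
  proof (intro ballI allI impI)
    fix x y u v
    assume x: "x \<in> K - {0}" and y: "y \<in> K - {0}" and uv: "0 \<le> u" "0 \<le> v" "u + v = (1::real)"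
    have in_K: "u *\<^sub>R x + v *\<^sub>R y \<in> K" and uK: "u *\<^sub>R x \<in> K" and vK: "v *\<^sub>R y \<in> K"
      using x y uv proper_cone_scale[OF K] proper_cone_add[OF K] by auto
    have "u *\<^sub>R x + v *\<^sub>R y \<noteq> 0"
    proof
      assume eq: "u *\<^sub>R x + v *\<^sub>R y = 0"
      then have "- (u *\<^sub>R x) = v *\<^sub>R y" "- (v *\<^sub>R y) = u *\<^sub>R x"
        by (metis minus_unique, metis add.commute minus_unique)
      then have "u *\<^sub>R x = 0" "v *\<^sub>R y = 0"
        using proper_cone_pointed[OF K uK] proper_cone_pointed[OF K vK] uK vK by auto
      then show False using x y uv by auto
    qed
    then show "u *\<^sub>R x + v *\<^sub>R y \<in> K - {0}" using in_K by simp
  qed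
  then have "?S \<subseteq> K - {0}"
    by (intro hull_minimal) auto
  then have "0 \<notin> ?S" by blast
  moreover have "compact ?S"
    using K unfolding proper_cone_def
    by (intro compact_convex_hull closed_Int_compact) auto
  ultimately obtain a b where b: "0 < b" and ab: "\<And>x. x \<in> ?S \<Longrightarrow> b < a \<bullet> x"
    using separating_hyperplane_closed_0[of ?S] compact_imp_closed by (metis convex_convex_hull)
  have "b * norm x \<le> a \<bullet> x" if x: "x \<in> K" for x
  proof (cases "x = 0")
    case False
    have "(1 / norm x) *\<^sub>R x \<in> ?S"
      using proper_cone_scale[OF K x, of "1 / norm x"] False by (intro hull_inc) simp
    from ab[OF this] show ?thesis
      using False by (simp add: field_simps)
  qed simp
  with b that show ?thesis by blast
qed

text \<open>Normality of the cone: a functional as above is monotone and equivalent to the norm on \<open>K\<close>.\<close>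

lemma proper_cone_normal:
  assumes K: "proper_cone K"
  obtains C where "0 < C" "\<And>x y. x \<in> K \<Longrightarrow> y - x \<in> K \<Longrightarrow> norm x \<le> C * norm y"
proof -
  obtain a b where b: "0 < b" and ab: "\<And>x. x \<in> K \<Longrightarrow> b * norm x \<le> a \<bullet> x"
    using proper_cone_functional[OF K] by blast
  have "norm x \<le> ((norm a + 1) / b) * norm y" if "x \<in> K" "y - x \<in> K" for x y
  proof -
    have "b * norm x \<le> a \<bullet> x" using ab that by blast
    also have "\<dots> \<le> a \<bullet> y"
    proof -
      have "0 \<le> b * norm (y - x)" using b by simp
      with ab[OF that(2)] show ?thesis by (simp add: inner_diff_right)
    qed
    also have "\<dots> \<le> norm a * norm y" by (rule norm_cauchy_schwarz)
    also have "\<dots> \<le> (norm a + 1) * norm y" by (intro mult_right_mono) auto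
    finally show ?thesis using b by (simp add: field_simps)
  qed
  moreover have "0 < (norm a + 1) / b"
    using b by (intro divide_pos_pos) (auto simp: add_nonneg_pos)
  ultimately show ?thesis using that by blast
qed

lemma interior_absorbs:
  fixes u :: "'a :: real_normed_vector"
  assumes u: "u \<in> interior K"
  obtains s where "0 < s" "\<And>x. s * norm x \<le> 1 \<Longrightarrow> u - x \<in> K"
proof -
  obtain r where r: "0 < r" "cball u r \<subseteq> K"
    using u by (meson mem_interior_cball)
  have "u - x \<in> K" if "(1 / r) * norm x \<le> 1" for x
    using that r by (intro subsetD[OF r(2)]) (simp add: dist_norm field_simps)
  then show ?thesis using that[of "1 / r"] r by simp
qed

text \<open>
  An interior point is an order unit: every vector lies between two multiples of it, with a
  coefficient proportional to the norm.
\<close>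

lemma interior_proper_cone_order_unit:
  assumes K: "proper_cone K" and u: "u \<in> interior K"
  obtains s where "0 < s" "\<And>x. (s * norm x) *\<^sub>R u - x \<in> K"
proof -
  obtain s where s: "0 < s" "\<And>x. s * norm x \<le> 1 \<Longrightarrow> u - x \<in> K"
    using interior_absorbs[OF u] by blast
  have uK: "u \<in> K" using u interior_subset by blast
  have "(s * norm x) *\<^sub>R u - x \<in> K" for x
  proof (cases "x = 0")
    case False
    have "u - (1 / (s * norm x)) *\<^sub>R x \<in> K"
      using s False by (intro s(2)) simp
    from proper_cone_scale[OF K this, of "s * norm x"] show ?thesis
      using s False by (simp add: algebra_simps)
  next
    case True
    then show ?thesis using proper_cone_scale[OF K uK, of 0] by simp
  qed
  with s that show ?thesis by blast
qed

lemma zero_notin_interior_proper_cone: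
  fixes K :: "(real ^ 'n) set"
  assumes K: "proper_cone K"
  shows "0 \<notin> interior K"
proof
  assume "0 \<in> interior K"
  then obtain s where s: "\<And>x. (s * norm x) *\<^sub>R 0 - x \<in> K"
    using interior_proper_cone_order_unit[OF K] by blast
  have "x = 0" for x :: "real ^ 'n"
    using proper_cone_pointed[OF K, of x] s[of x] s[of "- x"] by simp
  \<comment> \<open>The dimension is positive, since index types are inhabited.\<close>
  from this[of "axis undefined 1"] show False by (simp add: axis_eq_0_iff)
qed

text \<open>All matrices that preserve \<open>K\<close> attain their norm, up to one common factor, at the order unit \<open>u\<close>.\<close>

lemma proper_cone_onorm_le:
  fixes K :: "(real ^ 'n) set"
  assumes K: "proper_cone K" and u: "u \<in> interior K"
  obtains c where "0 < c"
    "\<And>A :: real ^ 'n ^ 'n. \<forall>x\<in>K. A *v x \<in> K \<Longrightarrow> c * onorm ((*v) A) \<le> norm (A *v u)"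
proof -
  obtain s where s: "0 < s" "\<And>x. (s * norm x) *\<^sub>R u - x \<in> K"
    using interior_proper_cone_order_unit[OF assms] by blast
  obtain C where C: "0 < C" "\<And>x y. x \<in> K \<Longrightarrow> y - x \<in> K \<Longrightarrow> norm x \<le> C * norm y"
    using proper_cone_normal[OF K] by blast
  let ?D = "(2 * C + 1) * s"
  have D: "0 < ?D" using C s by simp
  have "1 / ?D * onorm ((*v) A) \<le> norm (A *v u)" if A: "\<forall>x\<in>K. A *v x \<in> K" for A :: "real ^ 'n ^ 'n"
  proof -
    have "norm (A *v x) \<le> (?D * norm (A *v u)) * norm x" for x
    proof -
      \<comment> \<open>From \<open>- r u \<le> x \<le> r u\<close> follows \<open>0 \<le> A (r u + x) \<le> 2 r A u\<close>, to which normality applies.\<close>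
      define r where "r = s * norm x"
      have r0: "0 \<le> r" using s by (simp add: r_def)
      have "A *v (r *\<^sub>R u - x) \<in> K" "A *v (r *\<^sub>R u + x) \<in> K"
        using s(2)[of x] s(2)[of "- x"] A by (auto simp: r_def)
      moreover have "(2 * r) *\<^sub>R (A *v u) - A *v (r *\<^sub>R u + x) = A *v (r *\<^sub>R u - x)"
        unfolding mult_2 scaleR_add_left by (simp add: algebra_simps)
      ultimately have "norm (A *v (r *\<^sub>R u + x)) \<le> C * norm ((2 * r) *\<^sub>R (A *v u))"
        by (intro C(2)) simp_all
      also have "\<dots> = 2 * C * r * norm (A *v u)" using r0 by simp
      finally have "norm (A *v (r *\<^sub>R u + x)) \<le> 2 * C * r * norm (A *v u)" .
      moreover have "norm (A *v x) \<le> norm (A *v (r *\<^sub>R u + x)) + norm (A *v (r *\<^sub>R u))"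
        using norm_triangle_ineq4[of "A *v (r *\<^sub>R u + x)" "A *v (r *\<^sub>R u)"]
        by (simp add: algebra_simps)
      moreover have "norm (A *v (r *\<^sub>R u)) = r * norm (A *v u)"
        by (simp only: matrix_vector_mult_scaleR norm_scaleR abs_of_nonneg[OF r0])
      ultimately have "norm (A *v x) \<le> 2 * C * r * norm (A *v u) + r * norm (A *v u)"
        by linarith
      then show ?thesis by (simp only: r_def) (simp add: algebra_simps)
    qed
    then have "onorm ((*v) A) \<le> ?D * norm (A *v u)"
      by (intro onorm_le) 
    then show ?thesis using D by (simp add: field_simps)
  qed
  then show ?thesis using that[of "1 / ?D"] D by simp
qed

text \<open>The unit vectors of \<open>K\<close> have a compact image in the open set \<open>interior K\<close>, which leaves room to
  subtract a fixed multiple of \<open>u\<close> from each of these images; homogeneity does the rest.\<close>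

lemma cone_positive_lower_bound:
  fixes K :: "(real ^ 'n) set"
  assumes K: "proper_cone K" and P: "cone_positive K P"
  obtains d where "0 < d" "\<And>x. x \<in> K \<Longrightarrow> P *v x - (d * norm x) *\<^sub>R u \<in> K"
proof -
  let ?S = "K \<inter> sphere 0 1"
  have S: "compact ?S"
    using K unfolding proper_cone_def by (intro closed_Int_compact) auto
  have "compact ((*v) P ` ?S)"
    by (intro compact_continuous_image S linear_continuous_on) simp
  moreover have "(*v) P ` ?S \<subseteq> interior K"
    using P unfolding cone_positive_def by (force simp: image_subset_iff)
  ultimately obtain e where e: "0 < e" "(\<Union>x\<in>(*v) P ` ?S. cball x e) \<subseteq> interior K"
    using compact_subset_open_imp_cball_epsilon_subset[OF _ open_interior] by metis
  define d where "d = e / (norm u + 1)"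
  have n: "0 < norm u + 1" by (simp add: add_nonneg_pos)
  have d: "0 < d" using e n by (simp_all add: d_def)
  have du: "d * norm u \<le> e" using n e by (simp add: d_def field_simps)
  have "P *v x - (d * norm x) *\<^sub>R u \<in> K" if x: "x \<in> K" for x
  proof (cases "x = 0")
    case False
    let ?x = "(1 / norm x) *\<^sub>R x"
    have "?x \<in> ?S"
      using proper_cone_scale[OF K x, of "1 / norm x"] False by simp
    moreover have "P *v ?x - d *\<^sub>R u \<in> cball (P *v ?x) e"
      using d du by (simp add: dist_norm)
    ultimately have "P *v ?x - d *\<^sub>R u \<in> K"
      using e interior_subset by blast
    from proper_cone_scale[OF K this, of "norm x"] False show ?thesis
      by (simp add: algebra_simps)
  qed (use x in simp)
  with d that show ?thesis by blast
qed

section \<open>Perron eigenvectors\<close>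

text \<open>Unless \<open>A\<close> annihilates a nonzero point of the cone, it maps the base of the cone that is
  cut out by a positive functional \<open>a\<close>, after rescaling, continuously into itself, and Brouwer's theorem yields a fixed
  point. Besides giving Perron eigenvectors, the lemma shows that every cone-preserving matrix has an
  eigenvalue.\<close>

lemma cone_preserving_eigenvector:
  fixes K :: "(real ^ 'n) set"
  assumes K: "proper_cone K" and A: "\<forall>x\<in>K. A *v x \<in> K"
  obtains v l where "v \<in> K" "v \<noteq> 0" "0 \<le> l" "A *v v = l *\<^sub>R v"
proof (cases "\<exists>x\<in>K. x \<noteq> 0 \<and> A *v x = 0")
  case True
  then show ?thesis using that[of _ 0] by auto
next
  case False
  obtain a b where b: "0 < b" and ab: "\<And>x. x \<in> K \<Longrightarrow> b * norm x \<le> a \<bullet> x"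
    using proper_cone_functional[OF K] by blast
  have pos: "0 < a \<bullet> x" if "x \<in> K" "x \<noteq> 0" for x
    using ab[OF that(1)] b that(2) by (meson less_le_trans mult_pos_pos zero_less_norm_iff)
  let ?S = "K \<inter> {x. a \<bullet> x = 1}"
  have "bounded ?S"
    unfolding bounded_iff using ab b
    by (intro exI[of _ "1 / b"]) (fastforce simp: field_simps)
  then have "compact ?S"
    using K closed_hyperplane[of a 1] unfolding proper_cone_def compact_eq_bounded_closed
    by (intro conjI closed_Int) auto
  moreover have "convex ?S"
    using K convex_hyperplane[of a 1] unfolding proper_cone_def by (intro convex_Int) auto
  moreover have "?S \<noteq> {}"
  proof -
    obtain w where w: "w \<in> interior K" using K unfolding proper_cone_def by blast
    then have wK: "w \<in> K" and "w \<noteq> 0"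
      using interior_subset zero_notin_interior_proper_cone[OF K] by auto
    then have "(1 / (a \<bullet> w)) *\<^sub>R w \<in> ?S"
      using pos[of w] proper_cone_scale[OF K wK, of "1 / (a \<bullet> w)"] by simp
    then show ?thesis by blast
  qed
  moreover have posA: "0 < a \<bullet> (A *v x)" if "x \<in> ?S" for x
  proof -
    have "x \<noteq> 0" using that by auto
    then show ?thesis using that A False by (intro pos) auto
  qed
  moreover have "continuous_on ?S (\<lambda>x. (1 / (a \<bullet> (A *v x))) *\<^sub>R (A *v x))"
    using posA by (intro continuous_intros) (auto simp: less_le)
  moreover have "(\<lambda>x. (1 / (a \<bullet> (A *v x))) *\<^sub>R (A *v x)) \<in> ?S \<rightarrow> ?S"
  proof
    fix x assume x: "x \<in> ?S"
    show "(1 / (a \<bullet> (A *v x))) *\<^sub>R (A *v x) \<in> ?S"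
      using posA[OF x] x A proper_cone_scale[OF K, of "A *v x" "1 / (a \<bullet> (A *v x))"] by auto
  qed
  ultimately obtain v where v: "v \<in> ?S" "(1 / (a \<bullet> (A *v v))) *\<^sub>R (A *v v) = v"
    using brouwer[of ?S] by blast
  have "A *v v = (a \<bullet> (A *v v)) *\<^sub>R ((1 / (a \<bullet> (A *v v))) *\<^sub>R (A *v v))"
    using posA[OF v(1)] by simp
  then have "A *v v = (a \<bullet> (A *v v)) *\<^sub>R v" by (simp only: v(2))
  moreover have "v \<noteq> 0" using v by auto
  ultimately show ?thesis
    using that[of v "a \<bullet> (A *v v)"] v posA[OF v(1)] by simp
qed

lemma cone_positive_preserves:
  assumes "cone_positive K P" "x \<in> K"
  shows "P *v x \<in> K"
proof (cases "x = 0")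
  case False
  then show ?thesis
    using assms interior_subset unfolding cone_positive_def by blast
qed (use assms in simp)

lemma interior_proper_cone_scale:
  assumes K: "proper_cone K" and x: "x \<in> interior K" and c: "0 < c"
  shows "c *\<^sub>R x \<in> interior K"
proof -
  have "(*\<^sub>R) c ` interior K \<subseteq> interior K"
  proof (rule interior_maximal)
    show "(*\<^sub>R) c ` interior K \<subseteq> K"
      using proper_cone_scale[OF K _ less_imp_le[OF c]] interior_subset by blast
    show "open ((*\<^sub>R) c ` interior K)"
      using open_scaling[of c "interior K"] c by simp
  qed
  then show ?thesis using x by blast
qed

lemma cone_positive_eigenvector:
  fixes K :: "(real ^ 'n) set"
  assumes K: "proper_cone K" and P: "cone_positive K P"
  obtains u l where "u \<in> interior K" "0 < l" "P *v u = l *\<^sub>R u"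
proof -
  obtain u l where u: "u \<in> K" "u \<noteq> 0" "0 \<le> l" "P *v u = l *\<^sub>R u"
    using cone_preserving_eigenvector[OF K] cone_positive_preserves[OF P] by blast
  have lu: "l *\<^sub>R u \<in> interior K"
    using P u unfolding cone_positive_def by force
  then have "l \<noteq> 0"
    using zero_notin_interior_proper_cone[OF K] by auto
  with u(3) have l: "0 < l" by simp
  then have "u \<in> interior K"
    using interior_proper_cone_scale[OF K lu, of "1 / l"] by simp
  with l u(4) that show ?thesis by blast
qed

text \<open>If \<open>v\<close> dominates \<open>a w\<close>, applying \<open>A\<close> repeatedly shows that \<open>l^k v\<close> dominates \<open>a c^k w\<close> for all
  \<open>k\<close>; with \<open>l < c\<close> a positive functional would give a contradiction as \<open>k\<close> grows.\<close>

lemma eigenvalue_ge_of_interior_eigenvector: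
  fixes K :: "(real ^ 'n) set"
  assumes K: "proper_cone K" and A: "\<forall>x\<in>K. A *v x \<in> K"
    and v: "v \<in> interior K" "A *v v = l *\<^sub>R v" "0 \<le> l"
    and w: "w \<in> K" "w \<noteq> 0" "A *v w - c *\<^sub>R w \<in> K"
  shows "c \<le> l"
proof (rule ccontr)
  assume "\<not> c \<le> l"
  then have c: "l < c" "0 < c" using v(3) by auto
  obtain s where s: "0 < s" "\<And>x. s * norm x \<le> 1 \<Longrightarrow> v - x \<in> K"
    using interior_absorbs[OF v(1)] by blast
  define a where "a = 1 / (s * norm w)"
  have a: "0 < a" using s w by (simp add: a_def)
  obtain f b where b: "0 < b" and f: "\<And>x. x \<in> K \<Longrightarrow> b * norm x \<le> f \<bullet> x"
    using proper_cone_functional[OF K] by blast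
  have iter: "l ^ k *\<^sub>R v - (a * c ^ k) *\<^sub>R w \<in> K" for k
  proof (induction k)
    case 0
    show ?case using s w a_def by (auto intro!: s(2))
  next
    case (Suc k)
    have "A *v (l ^ k *\<^sub>R v - (a * c ^ k) *\<^sub>R w) \<in> K" using A Suc by blast
    moreover have "(a * c ^ k) *\<^sub>R (A *v w - c *\<^sub>R w) \<in> K"
      using proper_cone_scale[OF K w(3)] a c by simp
    ultimately have
      "A *v (l ^ k *\<^sub>R v - (a * c ^ k) *\<^sub>R w) + (a * c ^ k) *\<^sub>R (A *v w - c *\<^sub>R w) \<in> K"
      by (rule proper_cone_add[OF K])
    then show ?case
      by (simp add: matrix_vector_mult_diff_distrib matrix_vector_mult_scaleR v(2)
          scaleR_diff_right mult_ac)
  qed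
  have fw: "0 < f \<bullet> w"
    using f[OF w(1)] b w(2) by (meson less_le_trans mult_pos_pos zero_less_norm_iff)
  have bound: "a * (f \<bullet> w) \<le> (l / c) ^ k * (f \<bullet> v)" for k
  proof -
    have "0 \<le> b * norm (l ^ k *\<^sub>R v - (a * c ^ k) *\<^sub>R w)" using b by simp
    also have "\<dots> \<le> f \<bullet> (l ^ k *\<^sub>R v - (a * c ^ k) *\<^sub>R w)" using f iter by blast
    finally have "a * c ^ k * (f \<bullet> w) \<le> l ^ k * (f \<bullet> v)"
      by (simp add: inner_diff_right)
    then show ?thesis using c by (simp add: power_divide field_simps)
  qed
  have "(\<lambda>k. (l / c) ^ k * (f \<bullet> v)) \<longlonglongrightarrow> 0 * (f \<bullet> v)"
    using c v(3) by (intro tendsto_intros LIMSEQ_realpow_zero) auto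
  then have "a * (f \<bullet> w) \<le> 0 * (f \<bullet> v)"
    by (rule LIMSEQ_le_const) (use bound in blast)
  then show False using a fw by (simp add: mult_le_0_iff)
qed

text \<open>With \<open>P\<close> on the right, the product annihilates no nonzero point of the cone unless \<open>A\<close>
  annihilates \<open>u\<close>; with \<open>P\<close> on the left, its eigenvector is in the interior and \<open>P A P u\<close> dominates a multiple of \<open>u\<close>.\<close>

lemma cone_positive_sandwich_eigenvalue:
  fixes K :: "(real ^ 'n) set"
  assumes K: "proper_cone K" and P: "cone_positive K P"
  obtains c where "0 < c"
    "\<And>A :: real ^ 'n ^ 'n. \<forall>x\<in>K. A *v x \<in> K \<Longrightarrow>
      \<exists>v r. v \<noteq> 0 \<and> (P ** A ** P) *v v = r *\<^sub>R v \<and> c * onorm ((*v) A) \<le> r"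
proof -
  obtain u l where u: "u \<in> interior K" "0 < l" "P *v u = l *\<^sub>R u"
    using cone_positive_eigenvector[OF assms] by blast
  obtain b where b: "0 < b"
    "\<And>A :: real ^ 'n ^ 'n. \<forall>x\<in>K. A *v x \<in> K \<Longrightarrow> b * onorm ((*v) A) \<le> norm (A *v u)"
    using proper_cone_onorm_le[OF K u(1)] by blast
  obtain d where d: "0 < d" "\<And>x. x \<in> K \<Longrightarrow> P *v x - (d * norm x) *\<^sub>R u \<in> K"
    using cone_positive_lower_bound[OF assms, of u] by blast
  have uK: "u \<in> K" "u \<noteq> 0"
    using u(1) interior_subset zero_notin_interior_proper_cone[OF K] by auto
  have "\<exists>v r. v \<noteq> 0 \<and> (P ** A ** P) *v v = r *\<^sub>R v \<and> (l * d * b) * onorm ((*v) A) \<le> r"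
    if A: "\<forall>x\<in>K. A *v x \<in> K" for A :: "real ^ 'n ^ 'n"
  proof -
    let ?B = "P ** A ** P"
    have B: "?B *v x = P *v (A *v (P *v x))" for x
      by (simp flip: matrix_vector_mul_assoc)
    have BK: "\<forall>x\<in>K. ?B *v x \<in> K"
      using A cone_positive_preserves[OF P] by (simp add: B)
    obtain v r where v: "v \<in> K" "v \<noteq> 0" "0 \<le> r" "?B *v v = r *\<^sub>R v"
      using cone_preserving_eigenvector[OF K BK] by blast
    have "(l * d * b) * onorm ((*v) A) \<le> r"
    proof (cases "A *v u = 0")
      case True
      then have "b * onorm ((*v) A) \<le> 0" using b(2)[OF A] by simp
      then have "(l * d) * (b * onorm ((*v) A)) \<le> 0"
        using u(2) d(1) by (simp add: mult_le_0_iff)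
      then show ?thesis using v(3) by (simp add: mult_ac)
    next
      case False
      \<comment> \<open>As \<open>A u \<noteq> 0\<close>, no interior point \<open>y\<close> of the cone is annihilated by \<open>A\<close>, for \<open>y\<close> dominates a multiple of \<open>u\<close>.\<close>
      have "A *v (P *v v) \<noteq> 0"
      proof
        assume eq: "A *v (P *v v) = 0"
        have "d * norm v > 0" using d v by simp
        have "A *v (P *v v - (d * norm v) *\<^sub>R u) \<in> K" using A d(2)[OF v(1)] by blast
        then have "(d * norm v) *\<^sub>R - (A *v u) \<in> K"
          by (simp add: matrix_vector_mult_diff_distrib matrix_vector_mult_scaleR eq)
        from proper_cone_scale[OF K this, of "1 / (d * norm v)"] d(1) v(2)
        have "- (A *v u) \<in> K" by simp
        then show False using False A uK proper_cone_pointed[OF K, of "A *v u"] by blast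
      qed
      moreover have "A *v (P *v v) \<in> K" using A cone_positive_preserves[OF P v(1)] by blast
      ultimately have int: "r *\<^sub>R v \<in> interior K"
        using P unfolding cone_positive_def v(4)[symmetric] B by blast
      then have "r \<noteq> 0" using zero_notin_interior_proper_cone[OF K] by auto
      with v(3) have "0 < r" by simp
      then have vint: "v \<in> interior K"
        using interior_proper_cone_scale[OF K int, of "1 / r"] by simp
      have "?B *v u - (l * (d * norm (A *v u))) *\<^sub>R u \<in> K"
      proof -
        have "P *v (A *v u) - (d * norm (A *v u)) *\<^sub>R u \<in> K" using d(2) A uK by blast
        from proper_cone_scale[OF K this, of l] u(2) show ?thesis
          by (simp add: B u(3) matrix_vector_mult_scaleR scaleR_diff_right)
      qed
      then have "l * (d * norm (A *v u)) \<le> r"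
        using eigenvalue_ge_of_interior_eigenvector[OF K BK vint v(4,3) uK] by blast
      moreover have "(l * d) * (b * onorm ((*v) A)) \<le> (l * d) * norm (A *v u)"
        using b(2)[OF A] u(2) d(1) by (intro mult_left_mono) auto
      ultimately show ?thesis by (simp add: mult_ac)
    qed
    with v show ?thesis by blast
  qed
  moreover have "0 < l * d * b" using u d b by simp
  ultimately show ?thesis using that by blast
qed

section \<open>Powers of a positive matrix are nearly of rank one\<close>

text \<open>Doeblin's argument. If \<open>x\<close> lies between \<open>m u\<close> and \<open>M u\<close>, the two gaps \<open>x - m u\<close> and \<open>M u - x\<close> add up
  to \<open>(M - m) u\<close>, so one of them is at least half as long as \<open>(M - m) u\<close>. As \<open>T\<close> is positive,
  it moves the image of this gap away from the boundary, and the corresponding bound improves by a fixed fraction of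
  \<open>M - m\<close>.\<close>

lemma cone_positive_oscillation_contracts:
  fixes K :: "(real ^ 'n) set"
  assumes K: "proper_cone K" and T: "cone_positive K T" and u: "u \<in> interior K" "T *v u = u"
  obtains q where "0 \<le> q" "q < 1"
    "\<And>x m M. x - m *\<^sub>R u \<in> K \<Longrightarrow> M *\<^sub>R u - x \<in> K \<Longrightarrow>
      \<exists>m' M'. T *v x - m' *\<^sub>R u \<in> K \<and> M' *\<^sub>R u - T *v x \<in> K \<and> M' - m' = q * (M - m)"
proof -
  obtain d where d: "0 < d" "\<And>x. x \<in> K \<Longrightarrow> T *v x - (d * norm x) *\<^sub>R u \<in> K"
    using cone_positive_lower_bound[OF K T, of u] by blast
  have uK: "u \<in> K" "u \<noteq> 0"
    using u(1) interior_subset zero_notin_interior_proper_cone[OF K] by auto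
  define e where "e = min 1 (d * norm u / 2)"
  have e: "0 < e" "e \<le> 1" "e \<le> d * norm u / 2" using d uK by (simp_all add: e_def)
  have "\<exists>m' M'. T *v x - m' *\<^sub>R u \<in> K \<and> M' *\<^sub>R u - T *v x \<in> K \<and> M' - m' = (1 - e) * (M - m)"
    if lo: "x - m *\<^sub>R u \<in> K" and hi: "M *\<^sub>R u - x \<in> K" for x m M
  proof -
    have sum: "(x - m *\<^sub>R u) + (M *\<^sub>R u - x) = (M - m) *\<^sub>R u"
      by (simp add: scaleR_diff_left)
    then have in_K: "(M - m) *\<^sub>R u \<in> K"
      using proper_cone_add[OF K lo hi] by simp
    have "0 \<le> M - m"
    proof (rule ccontr)
      assume neg: "\<not> 0 \<le> M - m"
      then have "(m - M) *\<^sub>R u \<in> K" using proper_cone_scale[OF K uK(1)] by simp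
      moreover have "- ((M - m) *\<^sub>R u) = (m - M) *\<^sub>R u" by (simp add: scaleR_diff_left)
      ultimately have "(M - m) *\<^sub>R u = 0" using proper_cone_pointed[OF K in_K] by simp
      then show False using neg uK by simp
    qed
    then have "(M - m) * norm u \<le> norm (x - m *\<^sub>R u) + norm (M *\<^sub>R u - x)"
      using norm_triangle_ineq[of "x - m *\<^sub>R u" "M *\<^sub>R u - x"] by (simp only: sum) simp
    moreover have gain: "T *v y - (e * (M - m)) *\<^sub>R u \<in> K"
      if y: "y \<in> K" "(M - m) * norm u / 2 \<le> norm y" for y
    proof -
      have "e * (M - m) \<le> (d * norm u / 2) * (M - m)"
        using e \<open>0 \<le> M - m\<close> by (intro mult_right_mono) auto
      also have "\<dots> = d * ((M - m) * norm u / 2)" by simp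
      also have "\<dots> \<le> d * norm y" using y(2) d by (intro mult_left_mono) auto
      finally have "(d * norm y - e * (M - m)) *\<^sub>R u \<in> K"
        using proper_cone_scale[OF K uK(1)] by simp
      from proper_cone_add[OF K d(2)[OF y(1)] this] show ?thesis
        by (simp add: scaleR_diff_left)
    qed
    moreover have Tlo: "T *v (x - m *\<^sub>R u) = T *v x - m *\<^sub>R u"
      and Thi: "T *v (M *\<^sub>R u - x) = M *\<^sub>R u - T *v x"
      by (simp_all add: matrix_vector_mult_diff_distrib matrix_vector_mult_scaleR u)
    have TloK: "T *v x - m *\<^sub>R u \<in> K" and ThiK: "M *\<^sub>R u - T *v x \<in> K"
      using cone_positive_preserves[OF T lo] cone_positive_preserves[OF T hi]
      by (simp_all only: Tlo Thi)
    ultimately consider "(M - m) * norm u / 2 \<le> norm (x - m *\<^sub>R u)"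
      | "(M - m) * norm u / 2 \<le> norm (M *\<^sub>R u - x)" by linarith
    then show ?thesis
    proof cases
      case 1
      have "T *v x - (m + e * (M - m)) *\<^sub>R u \<in> K"
        using gain[OF lo 1] by (simp only: Tlo) (simp add: scaleR_add_left diff_diff_eq)
      then show ?thesis using ThiK
        by (intro exI[of _ "m + e * (M - m)"] exI[of _ M]) (simp add: algebra_simps)
    next
      case 2
      have "(M - e * (M - m)) *\<^sub>R u - T *v x = T *v (M *\<^sub>R u - x) - (e * (M - m)) *\<^sub>R u"
        by (simp add: Thi scaleR_diff_left)
      then have "(M - e * (M - m)) *\<^sub>R u - T *v x \<in> K"
        using gain[OF hi 2] by simp
      then show ?thesis using TloK
        by (intro exI[of _ m] exI[of _ "M - e * (M - m)"]) (simp add: algebra_simps)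
    qed
  qed
  then show ?thesis using that[of "1 - e"] e by simp
qed

text \<open>Iterating the contraction squeezes the columns of \<open>T^k\<close> between close multiples of \<open>u\<close>. Approximation for
  one large exponent is enough for the trace estimate, so the limit of the powers is never constructed.\<close>

lemma cone_positive_power_rank_one:
  fixes K :: "(real ^ 'n) set"
  assumes K: "proper_cone K" and T: "cone_positive K T" and u: "u \<in> interior K" "T *v u = u"
    and eps: "0 < eps"
  obtains k m where "1 \<le> k" "\<And>i. norm (matrix_power T k *v axis i 1 - (m $ i) *\<^sub>R u) \<le> eps"
proof -
  obtain q where q: "0 \<le> q" "q < 1"
    "\<And>x m M. x - m *\<^sub>R u \<in> K \<Longrightarrow> M *\<^sub>R u - x \<in> K \<Longrightarrow>
      \<exists>m' M'. T *v x - m' *\<^sub>R u \<in> K \<and> M' *\<^sub>R u - T *v x \<in> K \<and> M' - m' = q * (M - m)"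
    using cone_positive_oscillation_contracts[OF K T u] by blast
  obtain s where s: "0 < s" "\<And>x. (s * norm x) *\<^sub>R u - x \<in> K"
    using interior_proper_cone_order_unit[OF K u(1)] by blast
  obtain C where C: "0 < C" "\<And>x y. x \<in> K \<Longrightarrow> y - x \<in> K \<Longrightarrow> norm x \<le> C * norm y"
    using proper_cone_normal[OF K] by blast
  have squeeze: "\<exists>m M. matrix_power T k *v axis i 1 - m *\<^sub>R u \<in> K \<and>
      M *\<^sub>R u - matrix_power T k *v axis i 1 \<in> K \<and> M - m = q ^ k * (2 * s)" for k i
  proof (induction k)
    case 0
    have "axis i 1 - (- s) *\<^sub>R u \<in> K" "s *\<^sub>R u - axis i 1 \<in> K"
      using s(2)[of "axis i 1"] s(2)[of "- axis i 1"] by (simp_all add: add.commute)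
    then show ?case by (intro exI[of _ "- s"] exI[of _ s]) simp
  next
    case (Suc k)
    then obtain m M where "matrix_power T k *v axis i 1 - m *\<^sub>R u \<in> K"
      "M *\<^sub>R u - matrix_power T k *v axis i 1 \<in> K" and diff: "M - m = q ^ k * (2 * s)"
      by blast
    from q(3)[OF this(1,2)] show ?case
      by (simp add: diff mult_ac flip: matrix_vector_mul_assoc)
  qed
  have "(\<lambda>k. C * (q ^ k * (2 * s) * norm u)) \<longlonglongrightarrow> C * (0 * (2 * s) * norm u)"
    using q by (intro tendsto_intros LIMSEQ_realpow_zero)
  then have "eventually (\<lambda>k. C * (q ^ k * (2 * s) * norm u) < eps) sequentially"
    using eps by (intro order_tendstoD) auto
  then have "eventually (\<lambda>k. C * (q ^ k * (2 * s) * norm u) < eps \<and> 1 \<le> k) sequentially"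
    using eventually_ge_at_top[of 1] by (rule eventually_conj)
  then obtain k where k: "C * (q ^ k * (2 * s) * norm u) < eps" "1 \<le> k"
    by (auto simp: eventually_sequentially)
  have "\<exists>m. norm (matrix_power T k *v axis i 1 - m *\<^sub>R u) \<le> eps" for i
  proof -
    obtain m M where mM: "matrix_power T k *v axis i 1 - m *\<^sub>R u \<in> K"
      "M *\<^sub>R u - matrix_power T k *v axis i 1 \<in> K" and diff: "M - m = q ^ k * (2 * s)"
      using squeeze by blast
    have "norm (matrix_power T k *v axis i 1 - m *\<^sub>R u) \<le> C * norm ((M - m) *\<^sub>R u)"
      using mM by (intro C(2)) (simp_all add: scaleR_diff_left)
    also have "norm ((M - m) *\<^sub>R u) = q ^ k * (2 * s) * norm u"
      using q s by (simp add: diff abs_mult)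
    finally show ?thesis using k(1) by (intro exI[of _ m]) linarith
  qed
  then obtain m where "\<And>i. norm (matrix_power T k *v axis i 1 - m i *\<^sub>R u) \<le> eps"
    by metis
  then show ?thesis using that[of k "\<chi> i. m i"] k(2) by simp
qed

lemma trace_matrix_mult:
  fixes A B :: "real ^ 'n ^ 'n"
  shows "trace (A ** B) = (\<Sum>i\<in>UNIV. (A *v (B *v axis i 1)) $ i)"
proof -
  have "A *v (B *v axis i 1) = column i (A ** B)" for i
    unfolding matrix_vector_mul_assoc by (rule matrix_vector_mult_basis)
  then show ?thesis by (simp add: trace_def column_def)
qed

lemma matrix_vector_mult_axis_sum:
  fixes B :: "real ^ 'n ^ 'n"
  shows "B *v y = (\<Sum>i\<in>UNIV. (y $ i) *\<^sub>R (B *v axis i 1))"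
proof -
  have "B *v y = B *v (\<Sum>i\<in>UNIV. (y $ i) *\<^sub>R axis i 1)"
    using basis_expansion[of y] by (simp add: scalar_mult_eq_scaleR)
  then show ?thesis
    by (simp add: linear_sum[OF matrix_vector_mul_linear] matrix_vector_mult_scaleR)
qed

text \<open>With \<open>T^k \<approx> u m\<^sup>T\<close> up to columnwise errors \<open>eps\<close>, the trace of \<open>A T^k\<close> is \<open>m \<bullet> A u\<close> up to
  \<open>n eps \<parallel>A\<parallel>\<close>. For \<open>y\<close> in \<open>K\<close> the vector \<open>T^k y\<close> dominates \<open>d \<parallel>y\<parallel> u\<close> with \<open>d\<close> independent of \<open>k\<close>, because
  \<open>T u = u\<close>; hence \<open>m \<bullet> y\<close> is at least \<open>d \<parallel>y\<parallel> / 2\<close> once \<open>eps\<close> is small. The choice \<open>y = A u\<close> makes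
  the main term exceed the error.\<close>

lemma cone_positive_normalized_trace_ge:
  fixes K :: "(real ^ 'n) set"
  assumes K: "proper_cone K" and T: "cone_positive K T" and u: "u \<in> interior K" "T *v u = u"
  obtains k c where "0 < c"
    "\<And>A. \<forall>x\<in>K. A *v x \<in> K \<Longrightarrow> c * onorm ((*v) A) \<le> trace (A ** matrix_power T k)"
proof -
  let ?n = "real CARD('n)"
  have uK: "u \<in> K" "u \<noteq> 0"
    using u(1) interior_subset zero_notin_interior_proper_cone[OF K] by auto
  obtain b where b: "0 < b"
    "\<And>A :: real ^ 'n ^ 'n. \<forall>x\<in>K. A *v x \<in> K \<Longrightarrow> b * onorm ((*v) A) \<le> norm (A *v u)"
    using proper_cone_onorm_le[OF K u(1)] by blast
  obtain d where d: "0 < d" "\<And>x. x \<in> K \<Longrightarrow> T *v x - (d * norm x) *\<^sub>R u \<in> K"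
    using cone_positive_lower_bound[OF K T, of u] by blast
  obtain f g where g: "0 < g" and f: "\<And>x. x \<in> K \<Longrightarrow> g * norm x \<le> f \<bullet> x"
    using proper_cone_functional[OF K] by blast
  have fu: "0 < f \<bullet> u"
    using f[OF uK(1)] g uK(2) by (meson less_le_trans mult_pos_pos zero_less_norm_iff)
  \<comment> \<open>The first argument of \<open>min\<close> keeps half of \<open>d\<close> in the estimate of \<open>m \<bullet> y\<close>, the second one lets the error
    consume at most half of the main term \<open>d b / 2\<close> of the trace.\<close>
  define F where "F = norm f + 1"
  have f1: "0 < F" by (simp add: F_def add_nonneg_pos)
  define eps where "eps = min (d * (f \<bullet> u) / (2 * ?n * F)) (d * b / (4 * ?n))"
  have n: "0 < ?n" by simp
  have eps: "0 < eps"
    unfolding eps_def using d b fu n f1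
    by (intro min_less_iff_conj[THEN iffD2] conjI divide_pos_pos mult_pos_pos) auto
  have eps1: "?n * eps * norm f \<le> d / 2 * (f \<bullet> u)"
  proof -
    have "?n * eps * norm f \<le> ?n * eps * F"
      using n eps by (intro mult_left_mono) (auto simp: F_def)
    also have "\<dots> \<le> ?n * (d * (f \<bullet> u) / (2 * ?n * F)) * F"
      using n f1 unfolding eps_def by (intro mult_right_mono mult_left_mono) auto
    also have "\<dots> = d / 2 * (f \<bullet> u)" using f1 by simp
    finally show ?thesis .
  qed
  have eps2: "?n * eps \<le> d * b / 4"
  proof -
    have "?n * eps \<le> ?n * (d * b / (4 * ?n))" unfolding eps_def by (intro mult_left_mono) auto
    then show ?thesis by simp
  qed
  obtain k m where k: "1 \<le> k"
    and m: "\<And>i. norm (matrix_power T k *v axis i 1 - (m $ i) *\<^sub>R u) \<le> eps"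
    using cone_positive_power_rank_one[OF K T u eps] by metis
  define R where "R i = matrix_power T k *v axis i 1 - (m $ i) *\<^sub>R u" for i
  have R: "norm (R i) \<le> eps" and col: "matrix_power T k *v axis i 1 = (m $ i) *\<^sub>R u + R i" for i
    using m by (simp_all add: R_def)
  have pow: "matrix_power T k *v y - (d * norm y) *\<^sub>R u \<in> K" if y: "y \<in> K" for y
    using k
  proof (induction k rule: dec_induct)
    case base
    then show ?case using d(2)[OF y] by simp
  next
    case (step j)
    from cone_positive_preserves[OF T step.IH] show ?case
      by (simp add: matrix_vector_mult_diff_distrib matrix_vector_mult_scaleR u
          flip: matrix_vector_mul_assoc)
  qed
  have functional: "d / 2 * norm y \<le> m \<bullet> y" if y: "y \<in> K" for y
  proof -
    have split: "matrix_power T k *v y = (m \<bullet> y) *\<^sub>R u + (\<Sum>i\<in>UNIV. (y $ i) *\<^sub>R R i)"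
      by (subst matrix_vector_mult_axis_sum)
        (simp add: col inner_vec_def scaleR_add_right sum.distrib scaleR_sum_left mult.commute)
    have "norm (\<Sum>i\<in>UNIV. (y $ i) *\<^sub>R R i) \<le> (\<Sum>i\<in>(UNIV :: 'n set). norm y * eps)"
      by (intro sum_norm_le) (simp add: R mult_mono component_le_norm_cart)
    then have rest: "norm (\<Sum>i\<in>UNIV. (y $ i) *\<^sub>R R i) \<le> ?n * eps * norm y"
      by (simp add: mult_ac)
    have "0 \<le> g * norm (matrix_power T k *v y - (d * norm y) *\<^sub>R u)" using g by simp
    also have "\<dots> \<le> f \<bullet> (matrix_power T k *v y - (d * norm y) *\<^sub>R u)" using f pow[OF y] by blast
    finally have "d * norm y * (f \<bullet> u)
        \<le> (m \<bullet> y) * (f \<bullet> u) + f \<bullet> (\<Sum>i\<in>UNIV. (y $ i) *\<^sub>R R i)"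
      by (simp add: split inner_diff_right inner_add_right)
    also have "f \<bullet> (\<Sum>i\<in>UNIV. (y $ i) *\<^sub>R R i) \<le> norm f * (?n * eps * norm y)"
      by (rule order_trans[OF norm_cauchy_schwarz mult_left_mono[OF rest norm_ge_zero]])
    also have "norm f * (?n * eps * norm y) = (?n * eps * norm f) * norm y" by simp
    also have "\<dots> \<le> (d / 2 * (f \<bullet> u)) * norm y" by (rule mult_right_mono[OF eps1 norm_ge_zero])
    finally have "(d / 2 * norm y) * (f \<bullet> u) \<le> (m \<bullet> y) * (f \<bullet> u)" by (simp add: algebra_simps)
    then show ?thesis using fu by simp
  qed
  have "(d * b / 4) * onorm ((*v) A) \<le> trace (A ** matrix_power T k)"
    if A: "\<forall>x\<in>K. A *v x \<in> K" for A
  proof -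
    have onorm0: "0 \<le> onorm ((*v) A)" by (simp add: onorm_pos_le)
    have entry: "- (onorm ((*v) A) * eps) \<le> (A *v R i) $ i" for i
    proof -
      have "\<bar>(A *v R i) $ i\<bar> \<le> norm (A *v R i)" by (rule component_le_norm_cart)
      also have "\<dots> \<le> onorm ((*v) A) * norm (R i)" by (rule onorm) simp
      also have "\<dots> \<le> onorm ((*v) A) * eps" using R onorm0 by (rule mult_left_mono)
      finally show ?thesis by simp
    qed
    have "(d / 2) * (b * onorm ((*v) A)) \<le> d / 2 * norm (A *v u)"
      using b(2)[OF A] d(1) by (intro mult_left_mono) auto
    also have "\<dots> \<le> m \<bullet> (A *v u)" using functional A uK by blast
    finally have main: "d / 2 * (b * onorm ((*v) A)) \<le> m \<bullet> (A *v u)" .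
    have "(\<Sum>i\<in>(UNIV :: 'n set). - (onorm ((*v) A) * eps)) \<le> (\<Sum>i\<in>UNIV. (A *v R i) $ i)"
      by (intro sum_mono entry)
    then have "- (?n * eps * onorm ((*v) A)) \<le> (\<Sum>i\<in>UNIV. (A *v R i) $ i)" by (simp add: mult_ac)
    moreover have "?n * eps * onorm ((*v) A) \<le> d * b / 4 * onorm ((*v) A)"
      by (rule mult_right_mono[OF eps2 onorm0])
    moreover have "trace (A ** matrix_power T k) = m \<bullet> (A *v u) + (\<Sum>i\<in>UNIV. (A *v R i) $ i)"
      by (simp add: trace_matrix_mult col matrix_vector_right_distrib matrix_vector_mult_scaleR
          inner_vec_def sum.distrib)
    ultimately show ?thesis using main by (simp add: algebra_simps)
  qed
  moreover have "0 < d * b / 4" using d b by simp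
  ultimately show ?thesis using that by blast
qed

lemma matrix_power_scaleR:
  "matrix_power (c *\<^sub>R A) k = c ^ k *\<^sub>R matrix_power A k"
proof (induction k)
  case (Suc k)
  then show ?case
    by (simp add: matrix_matrix_mult_def vec_eq_iff sum_distrib_left mult_ac)
qed simp

lemma cone_positive_power_trace_ge:
  fixes K :: "(real ^ 'n) set"
  assumes K: "proper_cone K" and P: "cone_positive K P"
  obtains k c where "0 < c"
    "\<And>A. \<forall>x\<in>K. A *v x \<in> K \<Longrightarrow> c * onorm ((*v) A) \<le> trace (A ** matrix_power P k)"
proof -
  obtain u l where u: "u \<in> interior K" "0 < l" "P *v u = l *\<^sub>R u"
    using cone_positive_eigenvector[OF assms] by blast
  define T where "T = (1 / l) *\<^sub>R P"
  have Tv: "T *v x = (1 / l) *\<^sub>R (P *v x)" for x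
    by (simp only: T_def scaleR_matrix_vector_assoc)
  have "cone_positive K T"
    using P interior_proper_cone_scale[OF K, of _ "1 / l"] u(2)
    unfolding cone_positive_def by (simp add: Tv image_subset_iff)
  moreover have "T *v u = u" using u by (simp add: Tv)
  ultimately obtain k c where c: "0 < c"
    "\<And>A. \<forall>x\<in>K. A *v x \<in> K \<Longrightarrow> c * onorm ((*v) A) \<le> trace (A ** matrix_power T k)"
    using cone_positive_normalized_trace_ge[OF K _ u(1), of T] by metis
  have "(l ^ k * c) * onorm ((*v) A) \<le> trace (A ** matrix_power P k)"
    if A: "\<forall>x\<in>K. A *v x \<in> K" for A
  proof -
    have P_eq: "P = l *\<^sub>R T" using u(2) by (simp add: T_def)
    have "trace (A ** matrix_power P k) = l ^ k * trace (A ** matrix_power T k)"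
      unfolding P_eq matrix_power_scaleR trace_def
      by (simp add: matrix_matrix_mult_def sum_distrib_left mult_ac)
    moreover have "l ^ k * (c * onorm ((*v) A)) \<le> l ^ k * trace (A ** matrix_power T k)"
      using c(2)[OF A] u(2) by (intro mult_left_mono) auto
    ultimately show ?thesis by simp
  qed
  moreover have "0 < l ^ k * c" using u c by simp
  ultimately show ?thesis using that by blast
qed

section \<open>Eigenvalues, spectral radius and trace\<close>

lemma eigenvalue_real:
  fixes A :: "real ^ 'n ^ 'n"
  assumes "v \<noteq> 0" "A *v v = r *\<^sub>R v"
  shows "complex_of_real r \<in> eigenvalues A"
proof -
  let ?v = "\<chi> i. complex_of_real (v $ i)"
  have "?v \<noteq> 0"
    using assms(1) by (auto simp: vec_eq_iff)
  moreover have "map_matrix complex_of_real A *v ?v = complex_of_real r *s ?v"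
  proof -
    have "(map_matrix complex_of_real A *v ?v) $ i = complex_of_real ((A *v v) $ i)" for i
      by (simp add: matrix_vector_mult_def)
    then show ?thesis by (simp add: vec_eq_iff assms(2))
  qed
  ultimately show ?thesis unfolding eigenvalues_def by blast
qed

lemma eigenvalue_cmod_le:
  fixes A :: "real ^ 'n ^ 'n"
  assumes "z \<in> eigenvalues A"
  shows "cmod z \<le> real CARD('n) * onorm ((*v) A)"
proof -
  obtain v where v: "v \<noteq> 0" "map_matrix complex_of_real A *v v = z *s v"
    using assms unfolding eigenvalues_def by blast
  \<comment> \<open>The eigenvector equation is compared with matrix entries in a coordinate of maximal modulus.\<close>
  define M where "M = Max (range (\<lambda>i. cmod (v $ i)))"
  have le: "cmod (v $ i) \<le> M" for i
    unfolding M_def by (intro Max_ge) auto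
  have "M \<in> range (\<lambda>i. cmod (v $ i))"
    unfolding M_def by (intro Max_in) auto
  then obtain k where k: "cmod (v $ k) = M" by blast
  have "0 < M"
  proof -
    obtain i where "v $ i \<noteq> 0" using v(1) by (auto simp: vec_eq_iff)
    then show ?thesis using le[of i] by (meson less_le_trans zero_less_norm_iff)
  qed
  have "cmod z * M = cmod ((map_matrix complex_of_real A *v v) $ k)"
    by (simp add: v(2) norm_mult k)
  also have "\<dots> \<le> (\<Sum>j\<in>UNIV. cmod (complex_of_real (A $ k $ j) * v $ j))"
    by (simp add: matrix_vector_mult_def norm_sum)
  also have "\<dots> \<le> (\<Sum>j\<in>(UNIV :: 'n set). onorm ((*v) A) * M)"
    by (intro sum_mono)
      (auto simp: norm_mult intro!: mult_mono le matrix_component_le_onorm onorm_pos_le)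
  also have "\<dots> = (real CARD('n) * onorm ((*v) A)) * M" by simp
  finally show ?thesis using \<open>0 < M\<close> by simp
qed

text \<open>The eigenvalues are the roots of the characteristic polynomial, taken here as a determinant over the
  ring of polynomials. Finiteness makes the maximum that defines the spectral radius meaningful.\<close>

lemma finite_eigenvalues:
  fixes A :: "real ^ 'n ^ 'n"
  shows "finite (eigenvalues A)"
proof -
  define B where "B = map_matrix complex_of_real A"
  define p where "p = det (\<chi> i j. (if i = j then [:0, 1:] else 0) - [:B $ i $ j:])"
  have p: "poly p z = det (mat z - B)" for z
    unfolding p_def det_def
    by (auto simp: poly_sum poly_prod mat_def of_int_poly intro!: sum.cong prod.cong)
  have ev: "z \<in> eigenvalues A \<longleftrightarrow> poly p z = 0" for z
  proof -
    have "mat z *v v = z *s v" for v :: "complex ^ 'n"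
      by (simp add: vec_eq_iff mat_def matrix_vector_mult_def if_distrib[of "\<lambda>x. x * _"]
          cong: if_cong)
    then have eq: "(mat z - B) *v v = z *s v - B *v v" for v
      by (simp add: matrix_vector_mult_diff_rdistrib)
    have "poly p z \<noteq> 0 \<longleftrightarrow> invertible (mat z - B)"
      by (simp add: p invertible_det_nz)
    also have "\<dots> \<longleftrightarrow> (\<forall>v. (mat z - B) *v v = 0 \<longrightarrow> v = 0)"
      by (simp add: invertible_left_inverse matrix_left_invertible_ker)
    also have "\<dots> \<longleftrightarrow> z \<notin> eigenvalues A"
      unfolding eq eigenvalues_def by (auto simp: B_def)
    finally show ?thesis by blast
  qed
  \<comment> \<open>The characteristic polynomial is not the zero polynomial, since eigenvalues are bounded.\<close>
  define z where "z = complex_of_real (real CARD('n) * onorm ((*v) A) + 1)"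
  have "0 \<le> real CARD('n) * onorm ((*v) A)"
    by (simp add: onorm_pos_le)
  then have "real CARD('n) * onorm ((*v) A) < cmod z"
    unfolding z_def norm_of_real by linarith
  then have "z \<notin> eigenvalues A"
    using eigenvalue_cmod_le[of z A] by auto
  then have "p \<noteq> 0"
    unfolding ev by (metis poly_0)
  moreover have "eigenvalues A = {z. poly p z = 0}"
    using ev by blast
  ultimately show ?thesis
    using poly_roots_finite[of p] by simp
qed

lemma spectral_radius_ge:
  assumes "v \<noteq> 0" "A *v v = r *\<^sub>R v"
  shows "r \<le> spectral_radius A"
proof -
  have "r \<le> cmod (complex_of_real r)" by simp
  also have "\<dots> \<le> spectral_radius A"
    unfolding spectral_radius_def
    using finite_eigenvalues eigenvalue_real[OF assms] by (intro Max_ge imageI finite_imageI)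
  finally show ?thesis .
qed

text \<open>A real eigenvector is assumed so that the set of eigenvalues, whose maximal modulus is taken,
  is known to be nonempty.\<close>

lemma spectral_radius_le:
  fixes A :: "real ^ 'n ^ 'n"
  assumes "v \<noteq> 0" "A *v v = r *\<^sub>R v"
  shows "spectral_radius A \<le> real CARD('n) * onorm ((*v) A)"
  unfolding spectral_radius_def
  using finite_eigenvalues eigenvalue_real[OF assms] eigenvalue_cmod_le
  by (subst Max_le_iff) auto

lemma trace_le_onorm:
  fixes A :: "real ^ 'n ^ 'n"
  shows "trace A \<le> real CARD('n) * onorm ((*v) A)"
proof -
  have "trace A \<le> (\<Sum>i\<in>(UNIV :: 'n set). onorm ((*v) A))"
    unfolding trace_def
    by (intro sum_mono) (meson abs_le_D1 matrix_component_le_onorm)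
  then show ?thesis by simp
qed

section \<open>Products of given length and the joint spectral radius\<close>

lemma foldr_matrix_mult:
  fixes As :: "(real ^ 'n ^ 'n) list"
  shows "foldr (**) As B = foldr (**) As (mat 1) ** B"
  by (induction As) (auto simp: matrix_mul_assoc)

lemma matrix_products_add:
  "matrix_products \<Sigma> (s + t) = {A ** B | A B. A \<in> matrix_products \<Sigma> s \<and> B \<in> matrix_products \<Sigma> t}"
proof (intro set_eqI iffI)
  fix C assume "C \<in> matrix_products \<Sigma> (s + t)"
  then obtain As where As: "C = foldr (**) As (mat 1)" "length As = s + t" "set As \<subseteq> \<Sigma>"
    unfolding matrix_products_def by blast
  have "C = foldr (**) (take s As) (foldr (**) (drop s As) (mat 1))"
    by (simp add: As(1) flip: foldr_append)
  then have "C = foldr (**) (take s As) (mat 1) ** foldr (**) (drop s As) (mat 1)"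
    by (metis foldr_matrix_mult)
  moreover have "length (take s As) = s" "length (drop s As) = t" using As by auto
  moreover have "set (take s As) \<subseteq> \<Sigma>" "set (drop s As) \<subseteq> \<Sigma>"
    using As(3) set_take_subset set_drop_subset by fast+
  ultimately show "C \<in> {A ** B | A B. A \<in> matrix_products \<Sigma> s \<and> B \<in> matrix_products \<Sigma> t}"
    unfolding matrix_products_def by blast
next
  fix C assume "C \<in> {A ** B | A B. A \<in> matrix_products \<Sigma> s \<and> B \<in> matrix_products \<Sigma> t}"
  then obtain As Bs where C: "C = foldr (**) As (mat 1) ** foldr (**) Bs (mat 1)"
    and len: "length As = s" "length Bs = t" and sub: "set As \<subseteq> \<Sigma>" "set Bs \<subseteq> \<Sigma>"
    unfolding matrix_products_def by blast
  have "C = foldr (**) (As @ Bs) (mat 1)" "length (As @ Bs) = s + t" "set (As @ Bs) \<subseteq> \<Sigma>"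
    using C foldr_matrix_mult[of As "foldr (**) Bs (mat 1)"] len sub by auto
  then show "C \<in> matrix_products \<Sigma> (s + t)"
    unfolding matrix_products_def by blast
qed

lemma matrix_products_0: "matrix_products \<Sigma> 0 = {mat 1}"
  unfolding matrix_products_def by auto

lemma matrix_products_1: "matrix_products \<Sigma> (Suc 0) = \<Sigma>"
  unfolding matrix_products_def
  by (force simp: length_Suc_conv)

lemma matrix_products_mult:
  "A \<in> matrix_products \<Sigma> s \<Longrightarrow> B \<in> matrix_products \<Sigma> t \<Longrightarrow> A ** B \<in> matrix_products \<Sigma> (s + t)"
  by (auto simp: matrix_products_add)

lemma matrix_power_in_products:
  "A \<in> matrix_products \<Sigma> s \<Longrightarrow> matrix_power A k \<in> matrix_products \<Sigma> (k * s)"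
  by (induction k) (simp_all add: matrix_products_0 matrix_products_mult)

lemma finite_matrix_products: "finite \<Sigma> \<Longrightarrow> finite (matrix_products \<Sigma> t)"
  unfolding matrix_products_def
  by (rule finite_subset[OF _ finite_imageI[OF finite_lists_length_eq[of \<Sigma> t]]]) auto

lemma matrix_products_nonempty: "\<Sigma> \<noteq> {} \<Longrightarrow> matrix_products \<Sigma> t \<noteq> {}"
proof (induction t)
  case (Suc t)
  then show ?case
    using matrix_products_add[of \<Sigma> "Suc 0" t] by (auto simp: matrix_products_1)
qed (simp add: matrix_products_0)

lemma matrix_products_preserve:
  assumes "\<And>A. A \<in> \<Sigma> \<Longrightarrow> \<forall>x\<in>K. A *v x \<in> K" "B \<in> matrix_products \<Sigma> t"
  shows "\<forall>x\<in>K. B *v x \<in> K"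
proof -
  have "\<forall>x\<in>K. foldr (**) As (mat 1) *v x \<in> K" if "set As \<subseteq> \<Sigma>" for As
    using that by (induction As) (auto simp: assms(1) simp flip: matrix_vector_mul_assoc)
  then show ?thesis using assms(2) unfolding matrix_products_def by blast
qed

definition max_product_norm :: "(real ^ 'n ^ 'n) set \<Rightarrow> nat \<Rightarrow> real" where
  "max_product_norm \<Sigma> t = Max ((\<lambda>A. onorm ((*v) A)) ` matrix_products \<Sigma> t)"

lemma max_product_norm_attained:
  assumes "finite \<Sigma>" "\<Sigma> \<noteq> {}"
  obtains A where "A \<in> matrix_products \<Sigma> t" "onorm ((*v) A) = max_product_norm \<Sigma> t"
proof -
  have "max_product_norm \<Sigma> t \<in> (\<lambda>A. onorm ((*v) A)) ` matrix_products \<Sigma> t"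
    unfolding max_product_norm_def
    by (intro Max_in) (simp_all add: assms finite_matrix_products matrix_products_nonempty)
  then show ?thesis using that by force
qed

lemma onorm_le_max_product_norm:
  assumes "finite \<Sigma>" "A \<in> matrix_products \<Sigma> t"
  shows "onorm ((*v) A) \<le> max_product_norm \<Sigma> t"
  unfolding max_product_norm_def by (intro Max_ge) (simp_all add: assms finite_matrix_products)

lemma max_product_norm_nonneg:
  assumes "finite \<Sigma>" "\<Sigma> \<noteq> {}"
  shows "0 \<le> max_product_norm \<Sigma> t"
  by (metis assms max_product_norm_attained matrix_vector_mul_bounded_linear onorm_pos_le)

lemma max_product_norm_submult:
  fixes \<Sigma> :: "(real ^ 'n ^ 'n) set"
  assumes "finite \<Sigma>" "\<Sigma> \<noteq> {}"
  shows "max_product_norm \<Sigma> (s + t) \<le> max_product_norm \<Sigma> s * max_product_norm \<Sigma> t"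
proof -
  obtain C where C: "C \<in> matrix_products \<Sigma> (s + t)" "onorm ((*v) C) = max_product_norm \<Sigma> (s + t)"
    using max_product_norm_attained[OF assms] by blast
  then obtain A B where AB: "C = A ** B" "A \<in> matrix_products \<Sigma> s" "B \<in> matrix_products \<Sigma> t"
    by (auto simp: matrix_products_add)
  have "(*v) C = (*v) A \<circ> (*v) B"
    by (simp add: fun_eq_iff AB(1) matrix_vector_mul_assoc)
  then have "onorm ((*v) C) \<le> onorm ((*v) A) * onorm ((*v) B)"
    by (simp add: onorm_compose)
  also have "\<dots> \<le> max_product_norm \<Sigma> s * max_product_norm \<Sigma> t"
    using AB assms
    by (intro mult_mono onorm_le_max_product_norm max_product_norm_nonneg onorm_pos_le) auto
  finally show ?thesis using C by simp
qed

lemma root_Max_commute: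
  fixes f :: "'a \<Rightarrow> real"
  assumes "finite S" "S \<noteq> {}" "0 < t"
  shows "Max ((\<lambda>A. root t (f A)) ` S) = root t (Max (f ` S))"
proof -
  have "mono (root t)" using assms(3) by (intro monoI) simp
  from mono_Max_commute[OF this, of "f ` S"] show ?thesis
    using assms by (simp add: image_image)
qed

text \<open>Fekete's lemma in multiplicative form; the limit is the infimum \<open>L\<close>. If \<open>y > L\<close>, then \<open>a m \<le> y^m\<close> for some
  \<open>m \<ge> 1\<close>, and splitting off blocks of length \<open>m\<close> gives \<open>a n \<le> C y^n\<close> for all \<open>n\<close>. Zeros of \<open>a\<close> are
  allowed, which is why no logarithms are taken.\<close>

lemma submultiplicative_root_convergent:
  fixes a :: "nat \<Rightarrow> real"
  assumes nonneg: "\<And>n. 0 \<le> a n" and submult: "\<And>m n. a (m + n) \<le> a m * a n"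
  shows "convergent (\<lambda>n. root n (a n))"
proof -
  define L where "L = (INF n\<in>{1..}. root n (a n))"
  have bdd: "bdd_below ((\<lambda>n. root n (a n)) ` {1..})"
    by (rule bdd_belowI2[of _ 0]) (simp add: nonneg real_root_ge_zero)
  have lower: "L \<le> root n (a n)" if "n \<ge> 1" for n
    unfolding L_def by (rule cINF_lower[OF bdd]) (use that in simp)
  have "0 \<le> L"
    unfolding L_def by (rule cINF_greatest) (simp_all add: nonneg real_root_ge_zero)
  have upper: "eventually (\<lambda>n. root n (a n) < z) sequentially" if z: "L < z" for z
  proof -
    obtain y where y: "L < y" "y < z" using dense[OF z] by auto
    have "0 < y" using \<open>0 \<le> L\<close> y by simp
    have "\<exists>m\<in>{1..}. root m (a m) < y"
      using y(1) cINF_less_iff[OF _ bdd, of y] unfolding L_def by (metis atLeast_iff empty_iff order_refl)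
    then obtain m where m: "m \<ge> 1" "root m (a m) < y" by auto
    have am: "a m \<le> y ^ m"
    proof -
      have "a m = root m (a m) ^ m" using m nonneg by (simp add: real_root_pow_pos2)
      also have "\<dots> \<le> y ^ m"
        using m nonneg[of m] by (intro power_mono) (simp_all add: real_root_ge_zero)
      finally show ?thesis .
    qed
    \<comment> \<open>The sum takes care of the remainders below \<open>m\<close>; the summand \<open>1\<close> only makes \<open>C\<close> positive.\<close>
    define C where "C = (\<Sum>r<m. a r / y ^ r) + 1"
    have C: "0 < C"
      unfolding C_def using nonneg \<open>0 < y\<close>
      by (intro add_nonneg_pos sum_nonneg) auto
    have bound: "a n \<le> C * y ^ n" for n
    proof (induction n rule: less_induct)
      case (less n)
      show ?case
      proof (cases "n < m")
        case True
        then have "a n / y ^ n \<le> (\<Sum>r<m. a r / y ^ r)"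
          using nonneg \<open>0 < y\<close> by (intro member_le_sum[of n "{..<m}" "\<lambda>r. a r / y ^ r"]) auto
        then have "a n / y ^ n \<le> C" by (simp add: C_def)
        then show ?thesis using \<open>0 < y\<close> by (simp add: field_simps)
      next
        case False
        then have "a n \<le> a m * a (n - m)"
          using submult[of m "n - m"] by simp
        also have "\<dots> \<le> y ^ m * (C * y ^ (n - m))"
          using am less[of "n - m"] m False nonneg \<open>0 < y\<close> by (intro mult_mono) auto
        also have "\<dots> = C * (y ^ m * y ^ (n - m))" by simp
        also have "y ^ m * y ^ (n - m) = y ^ n"
          using False by (metis le_add_diff_inverse not_less power_add)
        finally show ?thesis .
      qed
    qed
    have "(\<lambda>n. root n C * y) \<longlonglongrightarrow> 1 * y"
      using C by (intro tendsto_intros LIMSEQ_root_const)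
    then have "eventually (\<lambda>n. root n C * y < z) sequentially"
      using y(2) by (intro order_tendstoD) auto
    then show ?thesis
      using eventually_gt_at_top[of 0]
    proof eventually_elim
      case (elim n)
      have "root n (a n) \<le> root n (C * y ^ n)" using elim bound by simp
      also have "\<dots> = root n C * root n (y ^ n)" by (rule real_root_mult)
      also have "root n (y ^ n) = y"
        using elim(2) less_imp_le[OF \<open>0 < y\<close>] by (rule real_root_power_cancel)
      finally show ?case using elim by simp
    qed
  qed
  have "(\<lambda>n. root n (a n)) \<longlonglongrightarrow> L"
  proof (rule order_tendstoI)
    fix z assume "z < L"
    then show "eventually (\<lambda>n. z < root n (a n)) sequentially"
      using lower by (intro eventually_mono[OF eventually_ge_at_top[of 1]]) (rule less_le_trans)
  qed (rule upper)
  then show ?thesis by (rule convergentI)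
qed

lemma joint_spectral_radius_limit:
  assumes "finite \<Sigma>" "\<Sigma> \<noteq> {}"
  shows "(\<lambda>t. root t (max_product_norm \<Sigma> t)) \<longlonglongrightarrow> joint_spectral_radius \<Sigma>"
proof -
  let ?f = "\<lambda>t. Max ((\<lambda>A. root t (onorm (\<lambda>x. A *v x))) ` matrix_products \<Sigma> t)"
  let ?g = "\<lambda>t. root t (max_product_norm \<Sigma> t)"
  have "eventually (\<lambda>t. ?f t = ?g t) sequentially"
    using eventually_gt_at_top[of 0]
    by eventually_elim
      (simp add: max_product_norm_def root_Max_commute assms finite_matrix_products matrix_products_nonempty)
  moreover have "convergent ?g"
    by (intro submultiplicative_root_convergent max_product_norm_nonneg max_product_norm_submult assms)
  then have "?g \<longlonglongrightarrow> lim ?g" by (simp add: convergent_LIMSEQ_iff)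
  ultimately have "?f \<longlonglongrightarrow> lim ?g"
    using tendsto_cong by fast
  then have "joint_spectral_radius \<Sigma> = lim ?g"
    unfolding joint_spectral_radius_def by (rule limI)
  with \<open>?g \<longlonglongrightarrow> lim ?g\<close> show ?thesis by simp
qed

text \<open>The comparison principle for a quantity \<open>f\<close> that is at most a multiple of the norm, and for which
  lengthening a product by \<open>N\<close> factors recovers a multiple of its norm. Submultiplicativity turns
  the bound by the norms at length \<open>t - N\<close> into one by the norms at length \<open>t\<close>, and constants
  disappear under the \<open>t\<close>-th root.\<close>

lemma root_max_tendsto_joint_spectral_radius:
  fixes \<Sigma> :: "(real ^ 'n ^ 'n) set" and f :: "real ^ 'n ^ 'n \<Rightarrow> real"
  assumes \<Sigma>: "finite \<Sigma>" "\<Sigma> \<noteq> {}"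
    and upper: "\<And>t A. A \<in> matrix_products \<Sigma> t \<Longrightarrow> f A \<le> C * onorm ((*v) A)"
    and lower: "\<And>t A. A \<in> matrix_products \<Sigma> t \<Longrightarrow>
      \<exists>B\<in>matrix_products \<Sigma> (t + N). c * onorm ((*v) A) \<le> f B"
    and "0 < c" "0 < C"
  shows "(\<lambda>t. Max ((\<lambda>A. root t (f A)) ` matrix_products \<Sigma> t)) \<longlonglongrightarrow> joint_spectral_radius \<Sigma>"
proof (rule tendsto_sandwich)
  define M where "M = max_product_norm \<Sigma>"
  \<comment> \<open>The summand \<open>1\<close> permits division even if all products of length \<open>N\<close> vanish.\<close>
  define D where "D = M N + 1"
  have M0: "0 \<le> M t" for t
    unfolding M_def by (intro max_product_norm_nonneg \<Sigma>)
  have D: "0 < D" using M0[of N] by (simp add: D_def)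
  have fin: "finite (matrix_products \<Sigma> t)" for t using \<Sigma> by (simp add: finite_matrix_products)
  have ne: "matrix_products \<Sigma> t \<noteq> {}" for t using \<Sigma> by (simp add: matrix_products_nonempty)
  have M_lim: "(\<lambda>t. root t (M t)) \<longlonglongrightarrow> joint_spectral_radius \<Sigma>"
    unfolding M_def by (intro joint_spectral_radius_limit \<Sigma>)
  have lim: "(\<lambda>t. root t b * root t (M t)) \<longlonglongrightarrow> joint_spectral_radius \<Sigma>" if "0 < b" for b
    using tendsto_mult[OF LIMSEQ_root_const[OF that] M_lim] by simp
  show "(\<lambda>t. root t (c / D) * root t (M t)) \<longlonglongrightarrow> joint_spectral_radius \<Sigma>"
    using \<open>0 < c\<close> D by (intro lim) simp
  show "(\<lambda>t. root t C * root t (M t)) \<longlonglongrightarrow> joint_spectral_radius \<Sigma>"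
    using \<open>0 < C\<close> by (intro lim)
  show "eventually (\<lambda>t. root t (c / D) * root t (M t)
      \<le> Max ((\<lambda>A. root t (f A)) ` matrix_products \<Sigma> t)) sequentially"
    using eventually_ge_at_top[of "N + 1"]
  proof eventually_elim
    case (elim t)
    obtain A where A: "A \<in> matrix_products \<Sigma> (t - N)" "onorm ((*v) A) = M (t - N)"
      using max_product_norm_attained[OF \<Sigma>] unfolding M_def by blast
    then obtain B where B: "B \<in> matrix_products \<Sigma> t" "c * M (t - N) \<le> f B"
      using lower[of A "t - N"] elim by auto
    have "M t \<le> M (t - N) * M N"
      using max_product_norm_submult[OF \<Sigma>, of "t - N" N] elim by (simp add: M_def)
    also have "\<dots> \<le> M (t - N) * D"
      using M0 by (intro mult_left_mono) (auto simp: D_def)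
    finally have "c / D * M t \<le> c / D * (M (t - N) * D)"
      using \<open>0 < c\<close> D by (intro mult_left_mono) auto
    also have "\<dots> \<le> f B" using B D by simp
    also have "\<dots> \<le> Max (f ` matrix_products \<Sigma> t)" using B fin by (intro Max_ge) auto
    finally have "root t (c / D * M t) \<le> root t (Max (f ` matrix_products \<Sigma> t))"
      using elim by simp
    then show ?case
      using elim root_Max_commute[OF fin[of t] ne[of t], of t f] by (simp only: real_root_mult)
  qed
  show "eventually (\<lambda>t. Max ((\<lambda>A. root t (f A)) ` matrix_products \<Sigma> t)
      \<le> root t C * root t (M t)) sequentially"
    using eventually_gt_at_top[of 0]
  proof eventually_elim
    case (elim t)
    have "f A \<le> C * M t" if A: "A \<in> matrix_products \<Sigma> t" for A
    proof -
      have "C * onorm ((*v) A) \<le> C * M t"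
        using onorm_le_max_product_norm[OF \<Sigma>(1) A] \<open>0 < C\<close> by (simp add: M_def)
      with upper[OF A] show ?thesis by linarith
    qed
    then have "Max (f ` matrix_products \<Sigma> t) \<le> C * M t"
      using fin ne by (subst Max_le_iff) auto
    then have "root t (Max (f ` matrix_products \<Sigma> t)) \<le> root t (C * M t)"
      using elim by simp
    then show ?case
      using elim by (simp add: root_Max_commute fin ne real_root_mult)
  qed
qed

theorem theorem6:
  fixes \<Sigma> :: "(real ^ 'n ^ 'n) set" and K :: "(real ^ 'n) set"
  assumes "finite \<Sigma>"
    and "proper_cone K"
    and "\<And>A. A \<in> \<Sigma> \<Longrightarrow> (\<lambda>x. A *v x) ` K \<subseteq> K"
    and "\<exists>A\<in>\<Sigma>. cone_primitive K A"
  shows "(\<lambda>t. Max ((\<lambda>A. root t (trace A)) ` matrix_products \<Sigma> t))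
           \<longlonglongrightarrow> joint_spectral_radius \<Sigma>
       \<and> (\<lambda>t. Max ((\<lambda>A. root t (spectral_radius A)) ` matrix_products \<Sigma> t))
           \<longlonglongrightarrow> joint_spectral_radius \<Sigma>"
proof -
  obtain A0 s where A0: "A0 \<in> \<Sigma>" and P: "cone_positive K (matrix_power A0 s)"
    using assms(4) unfolding cone_primitive_def by blast
  let ?P = "matrix_power A0 s"
  note K = assms(2)
  have \<Sigma>: "finite \<Sigma>" "\<Sigma> \<noteq> {}" using assms(1) A0 by auto
  have P_in: "?P \<in> matrix_products \<Sigma> s"
    using matrix_power_in_products[of A0 \<Sigma> "Suc 0" s] A0 by (simp add: matrix_products_1)
  have pres: "\<forall>x\<in>K. A *v x \<in> K" if A: "A \<in> matrix_products \<Sigma> t" for A t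
    using matrix_products_preserve[OF _ A] assms(3) by (simp add: image_subset_iff)
  obtain k c where c: "0 < c"
    "\<And>A. \<forall>x\<in>K. A *v x \<in> K \<Longrightarrow> c * onorm ((*v) A) \<le> trace (A ** matrix_power ?P k)"
    using cone_positive_power_trace_ge[OF K P] by blast
  have "(\<lambda>t. Max ((\<lambda>A. root t (trace A)) ` matrix_products \<Sigma> t))
      \<longlonglongrightarrow> joint_spectral_radius \<Sigma>"
  proof (rule root_max_tendsto_joint_spectral_radius[OF \<Sigma>])
    show "trace A \<le> real CARD('n) * onorm ((*v) A)" for A :: "real ^ 'n ^ 'n"
      by (rule trace_le_onorm)
    show "\<exists>B\<in>matrix_products \<Sigma> (t + k * s). c * onorm ((*v) A) \<le> trace B"
      if A: "A \<in> matrix_products \<Sigma> t" for t A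
      using matrix_products_mult[OF A matrix_power_in_products[OF P_in, of k]] c(2)[OF pres[OF A]]
      by blast
  qed (use c in auto)
  moreover obtain b where b: "0 < b"
    "\<And>A :: real ^ 'n ^ 'n. \<forall>x\<in>K. A *v x \<in> K \<Longrightarrow>
      \<exists>v r. v \<noteq> 0 \<and> (?P ** A ** ?P) *v v = r *\<^sub>R v \<and> b * onorm ((*v) A) \<le> r"
    using cone_positive_sandwich_eigenvalue[OF K P] by blast
  have "(\<lambda>t. Max ((\<lambda>A. root t (spectral_radius A)) ` matrix_products \<Sigma> t))
      \<longlonglongrightarrow> joint_spectral_radius \<Sigma>"
  proof (rule root_max_tendsto_joint_spectral_radius[OF \<Sigma>])
    show "spectral_radius A \<le> real CARD('n) * onorm ((*v) A)"
      if A: "A \<in> matrix_products \<Sigma> t" for t A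
      using cone_preserving_eigenvector[OF K pres[OF A]] spectral_radius_le by metis
    show "\<exists>B\<in>matrix_products \<Sigma> (t + (s + s)). b * onorm ((*v) A) \<le> spectral_radius B"
      if A: "A \<in> matrix_products \<Sigma> t" for t A
    proof
      show "?P ** A ** ?P \<in> matrix_products \<Sigma> (t + (s + s))"
        using matrix_products_mult[OF matrix_products_mult[OF P_in A] P_in] by (simp add: ac_simps)
      show "b * onorm ((*v) A) \<le> spectral_radius (?P ** A ** ?P)"
        using b(2)[OF pres[OF A]] spectral_radius_ge by (meson order_trans)
    qed
  qed (use b in auto)
  ultimately show ?thesis by blast
qed

end
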